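(* Let $K$ be an odd integer. Then $\omega_K(2)=\omega_K(4)=1$, and $\omega_K(2^x)=2$ for every integer $x\ge3$.
   Context: For an integer $K$, the $K$-Fibonacci sequence is $F_{K,0}=0$, $F_{K,1}=1$, $F_{K,n}=KF_{K,n-1}+F_{K,n-2}$ for $n\ge2$. For an integer $m\ge 2$, $\pi_K(m)$ is the least positive period of $(F_{K,n}\bmod m)$ and $\omega_K(m)$ is the number of indices $0\le n<\pi_K(m)$ with $m\mid F_{K,n}$. *)

theory Defs
  imports "HOL-Number_Theory.Cong"
begin

fun kfib :: "int \<Rightarrow> nat \<Rightarrow> int" where
  "kfib K 0 = 0"
| "kfib K (Suc 0) = 1"
| "kfib K (Suc (Suc n)) = K * kfib K (Suc n) + kfib K n"

text \<open>
  The recurrence can be run backwards over the integers, so for \<open>m \<ge> 2\<close> the sequence is purely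
  periodic modulo \<open>m\<close>: a positive period valid from index \<open>0\<close> always exists, and the
  \<open>LEAST\<close> below is attained.
\<close>

definition kfib_period :: "int \<Rightarrow> int \<Rightarrow> nat" where
  "kfib_period K m = (LEAST p. p > 0 \<and> (\<forall>n. [kfib K (n + p) = kfib K n] (mod m)))"

definition kfib_zeros :: "int \<Rightarrow> int \<Rightarrow> nat" where
  "kfib_zeros K m = card {n. n < kfib_period K m \<and> m dvd kfib K n}"

end

theory Submission
  imports Defs
begin

text \<open>
  If \<open>m\<close> divides \<open>F\<^sub>r\<close>, then shifting the index by \<open>r\<close> multiplies the sequence by \<open>F\<^sub>r\<^sub>+\<^sub>1\<close> modulo \<open>m\<close>.
  Hence, if \<open>r\<close> is the first positive zero, the zeros are the multiples of \<open>r\<close>, and their number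
  in a period is the multiplicative order of \<open>F\<^sub>r\<^sub>+\<^sub>1\<close> modulo \<open>m\<close>. For \<open>m = 2\<^sup>y\<^sup>+\<^sup>3\<close> and \<open>K\<close> odd, the
  doubling formulas show inductively that \<open>r = 6 \<cdot> 2\<^sup>y\<close>, that \<open>F\<^sub>r\<close> is an odd multiple of \<open>m\<close>, and
  that \<open>F\<^sub>r\<^sub>+\<^sub>1 - 1\<close> is an odd multiple of \<open>m / 2\<close>, so that this order is \<open>2\<close>.
\<close>

lemma kfib_add_Suc:
  "kfib K (Suc (m + n)) = kfib K (Suc m) * kfib K (Suc n) + kfib K m * kfib K n"
proof (induction m arbitrary: n)
  case (Suc m)
  show ?case using Suc[of "Suc n"] by (simp add: algebra_simps)
qed simp

lemma kfib_double_Suc: "kfib K (Suc (2 * n)) = (kfib K (Suc n))\<^sup>2 + (kfib K n)\<^sup>2"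
  using kfib_add_Suc[of K n n] by (simp add: mult_2 power2_eq_square)

text \<open>The second factor is the companion Lucas term
  \<open>F\<^sub>n\<^sub>+\<^sub>1 + F\<^sub>n\<^sub>-\<^sub>1\<close>, written without the index
  \<open>n - 1\<close> so that \<open>n = 0\<close> is no exception.\<close>

lemma kfib_double: "kfib K (2 * n) = kfib K n * (2 * kfib K (Suc n) - K * kfib K n)"
proof -
  have "kfib K (2 * n) = kfib K (Suc (Suc n + n)) - K * kfib K (Suc (2 * n))"
    by (simp add: mult_2)
  also have "\<dots> = kfib K n * (2 * kfib K (Suc n) - K * kfib K n)"
    unfolding kfib_add_Suc kfib_double_Suc by (simp add: algebra_simps power2_eq_square)
  finally show ?thesis .
qed

lemma kfib_shift_cong:
  assumes "m dvd kfib K r"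
  shows "[kfib K (n + r) = kfib K n * kfib K (Suc r)] (mod m)"
proof (cases n)
  case 0
  then show ?thesis using assms by (simp add: cong_0_iff)
next
  case (Suc k)
  then show ?thesis
    using assms kfib_add_Suc[of K k r] by (simp add: cong_iff_dvd_diff)
qed

text \<open>Two consecutive terms determine the sequence, so a shift is a period as soon as it
  restores the initial pair (0, 1).\<close>

lemma kfib_period_iff:
  "(\<forall>n. [kfib K (n + p) = kfib K n] (mod m)) \<longleftrightarrow>
    m dvd kfib K p \<and> [kfib K (Suc p) = 1] (mod m)"
proof
  assume *: "\<forall>n. [kfib K (n + p) = kfib K n] (mod m)"
  show "m dvd kfib K p \<and> [kfib K (Suc p) = 1] (mod m)"
    using *[rule_format, of 0] *[rule_format, of 1] by (simp add: cong_0_iff)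
next
  assume *: "m dvd kfib K p \<and> [kfib K (Suc p) = 1] (mod m)"
  show "\<forall>n. [kfib K (n + p) = kfib K n] (mod m)"
  proof
    fix n
    have "[kfib K n * kfib K (Suc p) = kfib K n * 1] (mod m)"
      using * by (intro cong_mult) auto
    then show "[kfib K (n + p) = kfib K n] (mod m)"
      using kfib_shift_cong[of m K p n] * by (auto intro: cong_trans)
  qed
qed

text \<open>Coprimality lets the multiplier \<open>kfib K (Suc r)\<close> be cancelled, so
  divisibility by \<open>m\<close> depends only on \<open>n mod r\<close>.\<close>

lemma dvd_kfib_iff:
  assumes "0 < r" and r: "m dvd kfib K r" and cop: "coprime m (kfib K (Suc r))"
    and least: "\<And>n. 0 < n \<Longrightarrow> n < r \<Longrightarrow> \<not> m dvd kfib K n"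
  shows "m dvd kfib K n \<longleftrightarrow> r dvd n"
proof -
  have step: "m dvd kfib K (n + r) \<longleftrightarrow> m dvd kfib K n" for n
    using cong_dvd_iff[OF kfib_shift_cong[OF r, of n]] cop
    by (simp add: coprime_dvd_mult_left_iff)
  have shift: "m dvd kfib K (n + j * r) \<longleftrightarrow> m dvd kfib K n" for n j
  proof (induction j)
    case (Suc j)
    then show ?case using step[of "n + j * r"] by (simp add: algebra_simps)
  qed simp
  have "m dvd kfib K n \<longleftrightarrow> m dvd kfib K (n mod r)"
    using shift[of "n mod r" "n div r"] by simp
  also have "\<dots> \<longleftrightarrow> n mod r = 0"
    using least[of "n mod r"] \<open>0 < r\<close> by auto
  finally show ?thesis by (simp add: dvd_eq_mod_eq_0)
qed

text \<open>Every period is itself a zero, hence some \<open>r * j\<close>; the least admissible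
  \<open>j\<close> is \<open>k\<close>, and the zeros below \<open>r * k\<close> are the
  \<open>r * j\<close> with \<open>j < k\<close>.\<close>

lemma kfib_zeros_eq:
  assumes "0 < r" "0 < k" and zeros: "\<And>n. m dvd kfib K n \<longleftrightarrow> r dvd n"
    and one: "[kfib K (Suc (r * k)) = 1] (mod m)"
    and least: "\<And>j. 0 < j \<Longrightarrow> j < k \<Longrightarrow> \<not> [kfib K (Suc (r * j)) = 1] (mod m)"
  shows "kfib_zeros K m = k"
proof -
  have "kfib_period K m = r * k"
    unfolding kfib_period_def
  proof (rule Least_equality)
    show "0 < r * k \<and> (\<forall>n. [kfib K (n + r * k) = kfib K n] (mod m))"
      using assms by (simp add: kfib_period_iff)
  next
    fix p assume "0 < p \<and> (\<forall>n. [kfib K (n + p) = kfib K n] (mod m))"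
    then have p: "0 < p" "r dvd p" "[kfib K (Suc p) = 1] (mod m)"
      by (simp_all only: kfib_period_iff zeros)
    then obtain j where j: "p = r * j" by auto
    with p least[of j] have "k \<le> j" by (metis mult_0_right not_gr0 not_le)
    then show "r * k \<le> p" using j by simp
  qed
  then have "{n. n < kfib_period K m \<and> m dvd kfib K n} = (\<lambda>j. r * j) ` {..<k}"
    using \<open>0 < r\<close> by (auto simp: zeros elim!: dvdE)
  moreover have "inj_on (\<lambda>j. r * j) {..<k}"
    using \<open>0 < r\<close> by (simp add: inj_on_def)
  ultimately show ?thesis
    by (simp add: kfib_zeros_def card_image)
qed

lemma odd_mult_self_mod_8:
  fixes K :: int
  assumes "odd K"
  obtains t where "K * K = 8 * t + 1"
proof -
  obtain a where a: "K = 2 * a + 1" using assms by (elim oddE)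
  have "even (a * (a + 1))" by simp
  then obtain t where "a * (a + 1) = 2 * t" by (elim evenE)
  with a have "K * K = 8 * t + 1" by (simp add: algebra_simps)
  then show ?thesis by (rule that)
qed

lemma kfib_six_times_power:
  fixes K :: int
  assumes "odd K"
  shows "\<exists>u v. odd u \<and> odd v \<and> kfib K (6 * 2 ^ y) = 8 * 2 ^ y * u \<and>
    kfib K (Suc (6 * 2 ^ y)) = 1 + 4 * 2 ^ y * v"
proof (induction y)
  case 0
  obtain t where K2: "K * K = 8 * t + 1" using odd_mult_self_mod_8[OF assms] .
  \<comment> \<open>These are \<open>K\<^sup>2 + 1\<close> and \<open>K * (K\<^sup>2 + 2)\<close>;
    doubling the index 3 then gives the terms at 6 and 7 as polynomials in \<open>t\<close>, up to a
    factor \<open>K\<close>.\<close>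
  have F3: "kfib K 3 = 8 * t + 2" and F4: "kfib K (Suc 3) = K * (8 * t + 3)"
    using K2 by (simp_all add: eval_nat_numeral algebra_simps)
  have "kfib K (6 * 2 ^ 0) = 8 * 2 ^ 0 * (K * ((4 * t + 1) * (2 * t + 1)))"
    using kfib_double[of K 3] unfolding F3 F4 by (simp add: algebra_simps)
  moreover have "kfib K (Suc (6 * 2 ^ 0)) = 1 + 4 * 2 ^ 0 * (128 * t ^ 3 + 128 * t\<^sup>2 + 38 * t + 3)"
  proof -
    have "kfib K (Suc (6 * 2 ^ 0)) = (K * K) * (8 * t + 3)\<^sup>2 + (8 * t + 2)\<^sup>2"
      using kfib_double_Suc[of K 3] unfolding F3 F4 by (simp add: power2_eq_square algebra_simps)
    then show ?thesis
      unfolding K2 by (simp add: algebra_simps power2_eq_square power3_eq_cube)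
  qed
  moreover have "odd (K * ((4 * t + 1) * (2 * t + 1)))" "odd (128 * t ^ 3 + 128 * t\<^sup>2 + 38 * t + 3)"
    using assms by simp_all
  ultimately show ?case by blast
next
  case (Suc y)
  define q :: int where "q = 2 ^ y"
  from Suc obtain u v where uv: "odd u" "odd v" "kfib K (6 * 2 ^ y) = 8 * q * u"
    "kfib K (Suc (6 * 2 ^ y)) = 1 + 4 * q * v"
    unfolding q_def by blast
  \<comment> \<open>Doubling the index gains exactly one factor 2 in both quantities: the new
    cofactors are \<open>u\<close> times an odd number and \<open>v\<close> plus an even
    number.\<close>
  have "kfib K (6 * 2 ^ Suc y) = 8 * 2 ^ Suc y * (u * (1 + 4 * q * v - 4 * K * q * u))"
    using kfib_double[of K "6 * 2 ^ y"] uv by (simp add: q_def algebra_simps)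
  moreover have "kfib K (Suc (6 * 2 ^ Suc y)) = 1 + 4 * 2 ^ Suc y * (v + 2 * (q * v\<^sup>2 + 4 * q * u\<^sup>2))"
    using kfib_double_Suc[of K "6 * 2 ^ y"] uv
    by (simp add: q_def algebra_simps power2_eq_square)
  moreover have "odd (u * (1 + 4 * q * v - 4 * K * q * u))" "odd (v + 2 * (q * v\<^sup>2 + 4 * q * u\<^sup>2))"
    using uv by simp_all
  ultimately show ?case by blast
qed

lemma coprime_power2_kfib_Suc_six:
  fixes K :: int
  assumes "odd K"
  shows "coprime (2 ^ x) (kfib K (Suc (6 * 2 ^ y)))"
  using kfib_six_times_power[OF assms, of y] by (auto simp del: kfib.simps)

lemma two_dvd_kfib_iff:
  fixes K :: int
  assumes "odd K"
  shows "2 dvd kfib K n \<longleftrightarrow> 3 dvd n"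
proof (rule dvd_kfib_iff)
  show "2 dvd kfib K 3" "coprime 2 (kfib K (Suc 3))"
    using assms by (simp_all add: eval_nat_numeral)
  fix n :: nat assume "0 < n" "n < 3"
  then have "n = 1 \<or> n = 2" by auto
  then show "\<not> 2 dvd kfib K n" using assms by (auto simp: eval_nat_numeral)
qed simp

text \<open>The moduli 4 and 8 share their first zero: the term at 3 is 2 modulo 8, while the term
  at 6 is already divisible by 8.\<close>

lemma four_or_eight_dvd_kfib_iff:
  fixes K :: int
  assumes "odd K" and m: "m = 4 \<or> m = 8"
  shows "m dvd kfib K n \<longleftrightarrow> 6 dvd n"
proof (rule dvd_kfib_iff)
  obtain u where "kfib K 6 = 8 * u"
    using kfib_six_times_power[OF assms(1), of 0] by auto
  then show "m dvd kfib K 6" using m by auto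
  show "coprime m (kfib K (Suc 6))"
    using m coprime_power2_kfib_Suc_six[OF assms(1), of 2 0]
      coprime_power2_kfib_Suc_six[OF assms(1), of 3 0] by (auto simp del: kfib.simps)
  fix n :: nat assume n: "0 < n" "n < 6"
  show "\<not> m dvd kfib K n"
  proof
    assume *: "m dvd kfib K n"
    then have "2 dvd kfib K n" using m by (auto elim!: dvdE)
    then have "n = 3" using n two_dvd_kfib_iff[OF assms(1), of n] by (auto elim!: dvdE)
    moreover obtain t where "K * K = 8 * t + 1" using odd_mult_self_mod_8[OF assms(1)] .
    ultimately have "m dvd 8 * t + 2" using * by (simp add: eval_nat_numeral add.commute)
    then have "4 dvd 8 * t + 2" using m by (auto elim: dvd_trans[rotated])
    then show False by presburger
  qed
qed simp

lemma power2_dvd_kfib_iff: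
  fixes K :: int
  assumes "odd K"
  shows "8 * 2 ^ y dvd kfib K n \<longleftrightarrow> 6 * 2 ^ y dvd n"
proof (induction y arbitrary: n)
  case 0
  show ?case using four_or_eight_dvd_kfib_iff[OF assms, of 8 n] by simp
next
  case (Suc y)
  show ?case
  proof (rule dvd_kfib_iff)
    show "8 * 2 ^ Suc y dvd kfib K (6 * 2 ^ Suc y)"
      using kfib_six_times_power[OF assms, of "Suc y"] by auto
    show "coprime (8 * 2 ^ Suc y) (kfib K (Suc (6 * 2 ^ Suc y)))"
      using coprime_power2_kfib_Suc_six[OF assms, of "Suc y + 3" "Suc y"]
      by (simp add: power_add del: kfib.simps)
    fix n :: nat assume n: "0 < n" "n < 6 * 2 ^ Suc y"
    show "\<not> 8 * 2 ^ Suc y dvd kfib K n"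
    proof
      assume *: "8 * 2 ^ Suc y dvd kfib K n"
      \<comment> \<open>A zero for the doubled modulus is one for the old modulus, so the only
        candidate below the new index is \<open>6 * 2 ^ y\<close>, where the odd cofactor
        \<open>u\<close> rules it out.\<close>
      have "8 * 2 ^ y dvd kfib K n" using * by (rule dvd_trans[rotated]) simp
      then obtain j where j: "n = 6 * 2 ^ y * j" using Suc by auto
      with n have "j = 1" by (cases j) auto
      moreover obtain u where "odd u" "kfib K (6 * 2 ^ y) = 8 * 2 ^ y * u"
        using kfib_six_times_power[OF assms, of y] by auto
      ultimately have "odd u" "8 * 2 ^ y * 2 dvd 8 * 2 ^ y * u"
        using * j by (simp_all add: mult.commute)
      then show False by (subst (asm) dvd_mult_cancel_left) simp
    qed
  qed simp
qed

theorem theorem4p25: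
  fixes K :: int
  assumes "odd K"
  shows "kfib_zeros K 2 = 1 \<and> kfib_zeros K 4 = 1 \<and> (\<forall>x::nat. x \<ge> 3 \<longrightarrow> kfib_zeros K (2 ^ x) = 2)"
proof (intro conjI allI impI)
  have "odd (kfib K (Suc 3))" using assms by (simp add: eval_nat_numeral)
  then show "kfib_zeros K 2 = 1"
    using assms
    by (intro kfib_zeros_eq[of 3]) (auto simp: two_dvd_kfib_iff cong_iff_dvd_diff simp del: kfib.simps)
  obtain v where "kfib K (Suc 6) = 1 + 4 * v"
    using kfib_six_times_power[OF assms, of 0] by auto
  then show "kfib_zeros K 4 = 1"
    using assms
    by (intro kfib_zeros_eq[of 6]) (auto simp: four_or_eight_dvd_kfib_iff cong_iff_dvd_diff simp del: kfib.simps)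
next
  fix x :: nat assume "3 \<le> x"
  then obtain y where "x = 3 + y" using le_Suc_ex by blast
  then have x: "(2::int) ^ x = 8 * 2 ^ y" by (simp add: power_add)
  obtain v where v: "odd v" "kfib K (Suc (6 * 2 ^ y)) = 1 + 4 * 2 ^ y * v"
    using kfib_six_times_power[OF assms, of y] by auto
  \<comment> \<open>At twice the first zero the deviation from 1 is a multiple of
    \<open>4 * 2 ^ Suc y\<close>, which is the modulus itself; at the first zero, \<open>v\<close>
    odd leaves it only half the modulus.\<close>
  obtain w where w: "kfib K (Suc (6 * 2 ^ Suc y)) = 1 + 4 * 2 ^ Suc y * w"
    using kfib_six_times_power[OF assms, of "Suc y"] by auto
  show "kfib_zeros K (2 ^ x) = 2"
    unfolding x
  proof (rule kfib_zeros_eq)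
    show "8 * 2 ^ y dvd kfib K n \<longleftrightarrow> 6 * 2 ^ y dvd n" for n
      by (rule power2_dvd_kfib_iff[OF assms])
    show "[kfib K (Suc (6 * 2 ^ y * 2)) = 1] (mod 8 * 2 ^ y)"
      using w by (simp add: cong_iff_dvd_diff mult.commute mult.left_commute del: kfib.simps)
    fix j :: nat assume "0 < j" "j < 2"
    then have "j = 1" by simp
    moreover have "\<not> 4 * 2 ^ y * 2 dvd 4 * 2 ^ y * v"
      using v(1) by (subst dvd_mult_cancel_left) simp
    ultimately show "\<not> [kfib K (Suc (6 * 2 ^ y * j)) = 1] (mod 8 * 2 ^ y)"
      using v(2) by (simp add: cong_iff_dvd_diff mult.commute del: kfib.simps)
  qed simp_all
qed

end
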